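(* Let $\mathbb{K}$ be a field, let $m,n$ be dimensions, and let $P=\begin{pmatrix}P_1&P_2\\P_3&P_4\end{pmatrix}\in GL_{m+n}(\mathbb{K})$ be partitioned so that $P_1$ is $m\times m$ (hence $P_4$ is $n\times n$). Let $p_i=\operatorname{rk}P_i$ for $i=1,2,3,4$. Suppose that $$P=\begin{pmatrix}I_m&0\\L&I_n\end{pmatrix}\begin{pmatrix}C_1&C_2\\0&C_4\end{pmatrix}\begin{pmatrix}I_m&0\\R&I_n\end{pmatrix}$$ for some matrices $L,R\in\mathbb{K}^{n\times m}$, $C_1\in\mathbb{K}^{m\times m}$, $C_2\in\mathbb{K}^{m\times n}$, $C_4\in\mathbb{K}^{n\times n}$. Then $$\operatorname{rk}C_2=p_2,\qquad \operatorname{rk}L\ge n-p_4,\qquad \operatorname{rk}R\ge m-p_1,\qquad \operatorname{rk}R+\operatorname{rk}L\ge p_3.$$ In particular, the rank of $C_2$ is fixed and $$\operatorname{rk}R+\operatorname{rk}L\ge\max(p_3,\;n+m-p_4-p_1).$$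
   Context: $I_k$ denotes the $k\times k$ identity matrix and $\operatorname{rk}$ denotes matrix rank. *)

theory Defs
  imports "Jordan_Normal_Form.DL_Rank"
begin

(* vec_space.rank takes the length of the columns as a locale
   parameter; rk reads it off the matrix. *)
abbreviation rk :: "'a :: field mat \<Rightarrow> nat" where
  "rk A \<equiv> vec_space.rank (dim_row A) A"

end

theory Submission
  imports Defs
begin

text \<open>
  Multiplying out the factorization and comparing blocks gives
  \<open>P1 = C1 + C2 * R\<close>, \<open>P2 = C2\<close>, \<open>P4 = C4 + L * C2\<close> and
  \<open>P3 = L * (C1 + C2 * R) + C4 * R = L * P1 + C4 * R\<close>.
  The claim about \<open>C2\<close> is the second of these. The others follow from two properties of the
  rank: it is subadditive, and the rank of a product is at most that of either factor
  (\<open>rank_add_mult_le\<close> combines them).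

  The formula for \<open>P3\<close> gives the bound by \<open>rk L + rk R\<close> directly. For the bounds on \<open>L\<close> and
  \<open>R\<close> alone, invertibility enters: \<open>det P = det C1 * det C4\<close>, so both diagonal blocks of the middle
  factor have full rank. Since \<open>C4\<close> and \<open>P4\<close> differ by \<open>L * C2\<close>, the rank of \<open>P4\<close> can
  fall short of \<open>n\<close> by at most the rank of \<open>L\<close>; likewise \<open>C1\<close> and \<open>P1\<close> differ by \<open>C2 * R\<close>.

  The bound of the rank of a product by its left factor is an inclusion of column spaces. As the
  rank is the dimension of the column space, the bound by the right factor needs another
  argument, which is the existence of a rank factorization.
\<close>

text \<open>Each column of \<open>A * B\<close> is \<open>A\<close> applied to a column of \<open>B\<close>, hence lies in the column space of \<open>A\<close>.\<close>

lemma (in vec_space) rank_mult_le_rank_left: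
  assumes A: "A \<in> carrier_mat n k" and B: "B \<in> carrier_mat k c"
  shows "rank (A * B) \<le> rank A"
proof -
  have AB: "A * B \<in> carrier_mat n c" using A B by simp
  have colsA: "set (cols A) \<subseteq> carrier_vec n" and colsAB: "set (cols (A * B)) \<subseteq> carrier_vec n"
    using cols_dim[of A] cols_dim[of "A * B"] A AB by auto
  have "set (cols (A * B)) \<subseteq> span (set (cols A))"
  proof
    fix v assume "v \<in> set (cols (A * B))"
    then obtain j where j: "j < c" and "v = col (A * B) j"
      using AB by (auto simp: cols_def)
    then have "v = A *\<^sub>v col B j" using col_mult2[OF A B j] by simp
    moreover have "col B j \<in> carrier_vec k" using B by auto
    ultimately show "v \<in> span (set (cols A))"
      using col_space_eq[OF A] A unfolding col_space_def by auto
  qed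
  then have "span (set (cols (A * B))) \<subseteq> span (set (cols A))"
    using colsA span_is_submodule span_is_subset by blast
  then have "subspace class_ring (span (set (cols (A * B)))) (vs (span (set (cols A))))"
    using nested_subspaces span_is_subspace colsA colsAB by simp
  then show ?thesis
    unfolding rank_def
    using vectorspace.subspace_dim[OF subspace_is_vs[OF span_is_subspace]]
      fin_dim_span_cols[OF A] fin_dim_span_cols[OF AB] colsA
    by simp
qed

text \<open>The columns of \<open>X\<close> are a basis of the column space of \<open>A\<close>, and the columns of \<open>Y\<close> are the coordinates
  of the columns of \<open>A\<close> in that basis. The inner dimension bounds the rank of every product \<open>Z * X * Y\<close>.\<close>

lemma (in vec_space) rank_factorization:
  assumes A: "A \<in> carrier_mat n c"
  obtains X Y where "X \<in> carrier_mat n (rank A)" and "Y \<in> carrier_mat (rank A) c"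
    and "A = X * Y"
proof -
  let ?W = "span (set (cols A))"
  have colsA: "set (cols A) \<subseteq> carrier_vec n" using cols_dim[of A] A by auto
  have W: "submodule class_ring ?W V" and Wvs: "vectorspace class_ring (vs ?W)"
    using span_is_submodule span_is_subspace subspace_is_vs colsA by simp_all
  obtain b where b: "finite b" "vectorspace.basis class_ring (vs ?W) b"
    using vectorspace.finite_basis_exists[OF Wvs fin_dim_span_cols[OF A]] by blast
  then have bW: "b \<subseteq> ?W" and "LinearCombinations.module.span class_ring (vs ?W) b = ?W"
    using vectorspace.basis_def[OF Wvs] by auto
  then have span_b: "span b = ?W" using span_li_not_depend(1)[OF bW W] by simp
  have card_b: "card b = rank A"
    unfolding rank_def using vectorspace.dim_basis[OF Wvs b] by simp
  obtain xs where xs: "set xs = b" "distinct xs" using finite_distinct_list[OF b(1)] by blast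
  have len: "length xs = rank A" using xs card_b distinct_card by fastforce
  define X where "X = mat_of_cols n xs"
  have X: "X \<in> carrier_mat n (rank A)" unfolding X_def using len by auto
  have xs_carrier: "set xs \<subseteq> carrier_vec n" using xs(1) bW W unfolding submodule_def by auto
  have "\<exists>y. y \<in> carrier_vec (rank A) \<and> X *\<^sub>v y = col A j" if j: "j < c" for j
  proof -
    have "col A j \<in> set (cols A)" using j A by (auto simp: cols_def)
    then have "col A j \<in> ?W" using span_mem[OF colsA] by blast
    then have "col A j \<in> col_space X"
      unfolding col_space_def X_def using xs_carrier xs(1) span_b by simp
    then show ?thesis using col_space_eq[OF X] X by auto
  qed
  then obtain y where y: "\<And>j. j < c \<Longrightarrow> y j \<in> carrier_vec (rank A) \<and> X *\<^sub>v y j = col A j"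
    by metis
  define Y where "Y = mat_of_cols (rank A) (map y [0..<c])"
  have Y: "Y \<in> carrier_mat (rank A) c" unfolding Y_def using mat_of_cols_carrier(1)[of "rank A" "map y [0..<c]"] by simp
  have "A = X * Y"
  proof (rule mat_col_eqI)
    show "dim_row A = dim_row (X * Y)" "dim_col A = dim_col (X * Y)" using A X Y by auto
    fix j assume "j < dim_col (X * Y)"
    then have j: "j < c" using Y by simp
    then have "col Y j = y j" unfolding Y_def using y by simp
    then show "col A j = col (X * Y) j" using col_mult2[OF X Y j] y[OF j] by simp
  qed
  with X Y that show thesis by blast
qed

text \<open>With a rank factorization \<open>B = X * Y\<close>, the matrix \<open>A * B\<close> is \<open>(A * X) * Y\<close>, and \<open>A * X\<close> has only
  \<open>rk B\<close> columns.\<close>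

lemma rank_mult_le_rank_right:
  assumes A: "A \<in> carrier_mat r k" and B: "B \<in> carrier_mat k c"
  shows "rk (A * B) \<le> rk B"
proof -
  have rk_B: "rk B = vec_space.rank k B" using B by simp
  obtain X Y where X: "X \<in> carrier_mat k (rk B)" and Y: "Y \<in> carrier_mat (rk B) c"
    and fac: "B = X * Y"
    using vec_space.rank_factorization[OF B] unfolding rk_B .
  have "A * B = (A * X) * Y" using assoc_mult_mat[OF A X Y] fac by simp
  then have "vec_space.rank r (A * B) \<le> vec_space.rank r (A * X)"
    using vec_space.rank_mult_le_rank_left[OF mult_carrier_mat[OF A X] Y] by simp
  also have "\<dots> \<le> rk B" using vec_space.rank_le_nc[OF mult_carrier_mat[OF A X]] .
  finally show ?thesis using A by simp
qed

text \<open>A perturbation of the form \<open>B * C\<close> raises the rank by at most the rank of either factor.\<close>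

lemma rank_add_mult_le:
  assumes A: "A \<in> carrier_mat r c" and B: "B \<in> carrier_mat r k" and C: "C \<in> carrier_mat k c"
  shows "rk (A + B * C) \<le> rk A + rk B" and "rk (A + B * C) \<le> rk A + rk C"
proof -
  have "rk (A + B * C) \<le> rk A + rk (B * C)"
    using vec_space.rank_subadditive[OF A mult_carrier_mat[OF B C]] A B C by simp
  moreover have "rk (B * C) \<le> rk B"
    using vec_space.rank_mult_le_rank_left[OF B C] B by simp
  moreover have "rk (B * C) \<le> rk C" using rank_mult_le_rank_right[OF B C] .
  ultimately show "rk (A + B * C) \<le> rk A + rk B" "rk (A + B * C) \<le> rk A + rk C" by simp_all
qed

lemma invertible_mat_det_nonzero:
  fixes A :: "'a :: field mat"
  assumes A: "A \<in> carrier_mat n n" and inv: "invertible_mat A"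
  shows "det A \<noteq> 0"
proof -
  obtain B where AB: "A * B = 1\<^sub>m n" and BA: "B * A = 1\<^sub>m (dim_row B)"
    using inv A unfolding invertible_mat_def inverts_mat_def by auto
  have "dim_col B = n" using AB by (metis index_mult_mat(3) index_one_mat(3))
  moreover have "dim_row B = n" using BA A by (metis carrier_matD(2) index_mult_mat(3) index_one_mat(3))
  ultimately have B: "B \<in> carrier_mat n n" by auto
  have "det A * det B = 1" using det_mult[OF A B] AB by simp
  then show ?thesis by auto
qed

lemma four_block_mat_inject:
  assumes A: "A1 \<in> carrier_mat r1 c1" "A2 \<in> carrier_mat r1 c2"
      "A3 \<in> carrier_mat r2 c1" "A4 \<in> carrier_mat r2 c2"
    and B: "B1 \<in> carrier_mat r1 c1" "B2 \<in> carrier_mat r1 c2"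
      "B3 \<in> carrier_mat r2 c1" "B4 \<in> carrier_mat r2 c2"
    and eq: "four_block_mat A1 A2 A3 A4 = four_block_mat B1 B2 B3 B4"
  shows "A1 = B1" and "A2 = B2" and "A3 = B3" and "A4 = B4"
proof -
  have entry: "four_block_mat A1 A2 A3 A4 $$ (i, j) = four_block_mat B1 B2 B3 B4 $$ (i, j)" for i j
    using eq by simp
  show "A1 = B1"
  proof (rule eq_matI)
    fix i j assume "i < dim_row B1" "j < dim_col B1"
    then show "A1 $$ (i, j) = B1 $$ (i, j)" using entry[of i j] A B by simp
  qed (use A B in auto)
  show "A2 = B2"
  proof (rule eq_matI)
    fix i j assume "i < dim_row B2" "j < dim_col B2"
    then show "A2 $$ (i, j) = B2 $$ (i, j)" using entry[of i "c1 + j"] A B by simp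
  qed (use A B in auto)
  show "A3 = B3"
  proof (rule eq_matI)
    fix i j assume "i < dim_row B3" "j < dim_col B3"
    then show "A3 $$ (i, j) = B3 $$ (i, j)" using entry[of "r1 + i" j] A B by simp
  qed (use A B in auto)
  show "A4 = B4"
  proof (rule eq_matI)
    fix i j assume "i < dim_row B4" "j < dim_col B4"
    then show "A4 $$ (i, j) = B4 $$ (i, j)" using entry[of "r1 + i" "c1 + j"] A B by simp
  qed (use A B in auto)
qed

text \<open>The lower left block is arranged so that the upper left block \<open>C1 + C2 * R\<close> of the product
  reappears in it. The block is then a sum of two products, one with factor \<open>L\<close> and one with
  factor \<open>R\<close>, which is what bounds its rank by \<open>rk L + rk R\<close>.\<close>

lemma lower_upper_lower_block_product:
  fixes L R C1 C2 C4 :: "'a :: comm_ring_1 mat"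
  assumes L: "L \<in> carrier_mat n m" and R: "R \<in> carrier_mat n m"
    and C1: "C1 \<in> carrier_mat m m" and C2: "C2 \<in> carrier_mat m n" and C4: "C4 \<in> carrier_mat n n"
  shows "four_block_mat (1\<^sub>m m) (0\<^sub>m m n) L (1\<^sub>m n)
           * four_block_mat C1 C2 (0\<^sub>m n m) C4
           * four_block_mat (1\<^sub>m m) (0\<^sub>m m n) R (1\<^sub>m n)
    = four_block_mat (C1 + C2 * R) C2 (L * (C1 + C2 * R) + C4 * R) (C4 + L * C2)"
proof -
  have LC: "four_block_mat (1\<^sub>m m) (0\<^sub>m m n) L (1\<^sub>m n) * four_block_mat C1 C2 (0\<^sub>m n m) C4
    = four_block_mat C1 C2 (L * C1) (L * C2 + C4)"
    by (subst mult_four_block_mat[of _ m m _ n _ n _ _ m _ n])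
       (use L C1 C2 C4 in simp_all)
  have "four_block_mat C1 C2 (L * C1) (L * C2 + C4) * four_block_mat (1\<^sub>m m) (0\<^sub>m m n) R (1\<^sub>m n)
    = four_block_mat (C1 + C2 * R) C2 (L * C1 + (L * C2 + C4) * R) (L * C2 + C4)"
    by (subst mult_four_block_mat[of _ m m _ n _ n _ _ m _ n])
       (use L R C1 C2 C4 in simp_all)
  moreover have "L * C1 + (L * C2 + C4) * R = L * (C1 + C2 * R) + C4 * R"
  proof -
    have "L * C1 + (L * C2 + C4) * R = L * C1 + (L * C2 * R + C4 * R)"
      using add_mult_distrib_mat[of "L * C2" n n C4 R m] L C2 C4 R by simp
    also have "\<dots> = (L * C1 + L * C2 * R) + C4 * R"
      using assoc_add_mat[of "L * C1" n m "L * C2 * R" "C4 * R"] L C1 C2 C4 R by simp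
    also have "L * C1 + L * C2 * R = L * (C1 + C2 * R)"
      using mult_add_distrib_mat[of L n m C1 m "C2 * R"] assoc_mult_mat[of L n m C2 n R m] L C1 C2 R
      by simp
    finally show ?thesis .
  qed
  moreover have "L * C2 + C4 = C4 + L * C2"
    using comm_add_mat[of "L * C2" n n C4] L C2 C4 by simp
  ultimately show ?thesis using LC by simp
qed

text \<open>These recover \<open>A\<close> from \<open>A + B * C\<close> by another perturbation of the form of a product, so that
  \<open>rank_add_mult_le\<close> can bound the rank of \<open>A\<close> from above. The sign may sit on either factor; keeping it off the
  factor whose rank is of interest avoids comparing the ranks of a matrix and its negative.\<close>

lemma add_mult_uminus_cancel:
  fixes A B C :: "'a :: comm_ring_1 mat"
  assumes A: "A \<in> carrier_mat r c" and B: "B \<in> carrier_mat r k" and C: "C \<in> carrier_mat k c"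
  shows "(A + B * C) + B * (- C) = A" and "(A + B * C) + (- B) * C = A"
proof -
  have BC: "B * C \<in> carrier_mat r c" using B C by simp
  have "B * C + - (B * C) = 0\<^sub>m r c"
    using minus_add_uminus_mat[OF BC BC] minus_r_inv_mat[OF BC] by simp
  then have "(A + B * C) + - (B * C) = A"
    using assoc_add_mat[OF A BC uminus_carrier_mat[OF BC]] A by simp
  then show "(A + B * C) + B * (- C) = A" "(A + B * C) + (- B) * C = A"
    using B C by simp_all
qed

theorem theorem1:
  fixes P P1 P2 P3 P4 L R C1 C2 C4 :: "'a :: field mat"
    and m n p1 p2 p3 p4 :: nat
  assumes "P1 \<in> carrier_mat m m" and "P2 \<in> carrier_mat m n"
    and "P3 \<in> carrier_mat n m" and "P4 \<in> carrier_mat n n"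
    and "P = four_block_mat P1 P2 P3 P4"
    and "invertible_mat P"
    and "p1 = rk P1" and "p2 = rk P2" and "p3 = rk P3" and "p4 = rk P4"
    and "L \<in> carrier_mat n m" and "R \<in> carrier_mat n m"
    and "C1 \<in> carrier_mat m m" and "C2 \<in> carrier_mat m n" and "C4 \<in> carrier_mat n n"
    and "P = four_block_mat (1\<^sub>m m) (0\<^sub>m m n) L (1\<^sub>m n)
           * four_block_mat C1 C2 (0\<^sub>m n m) C4
           * four_block_mat (1\<^sub>m m) (0\<^sub>m m n) R (1\<^sub>m n)"
  shows "rk C2 = p2
    \<and> int (rk L) \<ge> int n - int p4
    \<and> int (rk R) \<ge> int m - int p1
    \<and> rk R + rk L \<ge> p3
    \<and> int (rk R + rk L) \<ge> max (int p3) (int n + int m - int p4 - int p1)"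
proof -
  note P_blocks = assms(1-4)
  note L = assms(11) and R = assms(12) and C1 = assms(13) and C2 = assms(14) and C4 = assms(15)
  have prod: "four_block_mat P1 P2 P3 P4
      = four_block_mat (C1 + C2 * R) C2 (L * (C1 + C2 * R) + C4 * R) (C4 + L * C2)"
    using assms(5,16) lower_upper_lower_block_product[OF L R C1 C2 C4] by simp
  have C2R: "C1 + C2 * R \<in> carrier_mat m m" and LC2: "C4 + L * C2 \<in> carrier_mat n n"
    and lower: "L * (C1 + C2 * R) + C4 * R \<in> carrier_mat n m"
    using L R C1 C2 C4 by auto
  note blocks = four_block_mat_inject[OF P_blocks C2R C2 lower LC2 prod]

  have "det P \<noteq> 0"
    using invertible_mat_det_nonzero[OF four_block_carrier_mat[OF assms(1,4)]] assms(5,6) by simp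
  moreover have "det P = det C1 * det C4"
  proof -
    let ?U = "four_block_mat C1 C2 (0\<^sub>m n m) C4"
    let ?M = "\<lambda>X. four_block_mat (1\<^sub>m m) (0\<^sub>m m n) X (1\<^sub>m n)"
    have U: "?U \<in> carrier_mat (m + n) (m + n)" using C1 C4 by simp
    have M: "?M X \<in> carrier_mat (m + n) (m + n)" for X by simp
    have detM: "det (?M X) = 1" if "X \<in> carrier_mat n m" for X :: "'a mat"
      using that det_four_block_mat_upper_right_zero[OF one_carrier_mat refl _ one_carrier_mat] by simp
    have "det P = det (?M L) * det ?U * det (?M R)"
      unfolding assms(16)
      using det_mult[OF mult_carrier_mat[OF M U] M] det_mult[OF M U] by simp
    then show ?thesis
      using detM[OF L] detM[OF R] det_four_block_mat_lower_left_zero[OF C1 C2 refl C4] by simp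
  qed
  ultimately have rk_C1: "rk C1 = m" and rk_C4: "rk C4 = n"
    using vec_space.det_rank_iff[OF C1] vec_space.det_rank_iff[OF C4] C1 C4 by auto

  have L_ge: "n \<le> p4 + rk L"
    using rank_add_mult_le(1)[OF LC2 L uminus_carrier_mat[OF C2]]
      add_mult_uminus_cancel(1)[OF C4 L C2] blocks(4) rk_C4 assms(10) by simp
  have R_ge: "m \<le> p1 + rk R"
    using rank_add_mult_le(2)[OF C2R uminus_carrier_mat[OF C2] R]
      add_mult_uminus_cancel(2)[OF C1 C2 R] blocks(1) rk_C1 assms(7) by simp
  have sum_ge: "p3 \<le> rk R + rk L"
  proof -
    have "rk P3 \<le> rk (L * P1) + rk R"
      using rank_add_mult_le(2)[OF mult_carrier_mat[OF L assms(1)] C4 R] blocks(1,3) by simp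
    moreover have "rk (L * P1) \<le> rk L"
      using vec_space.rank_mult_le_rank_left[OF L assms(1)] L by simp
    ultimately show ?thesis using assms(9) by simp
  qed
  show ?thesis using L_ge R_ge sum_ge blocks(2) assms(8) by auto
qed

end
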